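(* The set $$S_{13}=\{1,2,3,13,23,25,41,75,369,533,6877,16675,3679538850\}$$ is GCD closed, its LCM matrix $[S_{13}]$ is singular, and the meet semilattice $(S_{13},\mid)$ does not have the $8$-element cube semilattice as a subsemilattice. In particular, it is not true that for every GCD closed set $S$ with singular LCM matrix the semilattice $(S,\mid)$ contains the $8$-element cube semilattice as a subsemilattice.
   Context: A finite set $S=\{x_1,\ldots,x_n\}$ of distinct positive integers is GCD closed if $\gcd(x_i,x_j)\in S$ for all $i,j$. Then $(S,\mid)$, i.e. $S$ ordered by divisibility, is a meet semilattice with meet $\gcd$. The LCM matrix $[S]$ is the $n\times n$ matrix whose $ij$ entry is $\mathrm{lcm}(x_i,x_j)$. The $8$-element cube semilattice is the Boolean lattice of subsets of a three-element set, regarded as a meet semilattice. A subsemilattice of $(S,\mid)$ is a subset of $S$ closed under $\gcd$, and $(S,\mid)$ has the cube as a subsemilattice if some subsemilattice is isomorphic to the cube semilattice. *)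

theory Defs
  imports "Jordan_Normal_Form.Determinant"
begin

definition gcd_closed :: "nat set \<Rightarrow> bool" where
  "gcd_closed S \<longleftrightarrow> finite S \<and> (\<forall>x\<in>S. 0 < x) \<and> (\<forall>x\<in>S. \<forall>y\<in>S. gcd x y \<in> S)"

(* The list xs = [x_1, ..., x_n] is an enumeration of the set S; the matrix depends on it
   only up to a simultaneous permutation of rows and columns. *)
definition lcm_matrix :: "nat list \<Rightarrow> real mat" where
  "lcm_matrix xs = mat (length xs) (length xs) (\<lambda>(i, j). real (lcm (xs ! i) (xs ! j)))"

definition singular_mat :: "real mat \<Rightarrow> bool" where
  "singular_mat A \<longleftrightarrow> square_mat A \<and> det A = 0"

definition meet_semilattice_iso ::
  "'a set \<Rightarrow> ('a \<Rightarrow> 'a \<Rightarrow> 'a) \<Rightarrow> 'b set \<Rightarrow> ('b \<Rightarrow> 'b \<Rightarrow> 'b) \<Rightarrow> bool" where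
  "meet_semilattice_iso A meetA B meetB \<longleftrightarrow>
     (\<exists>f. bij_betw f A B \<and> (\<forall>x\<in>A. \<forall>y\<in>A. f (meetA x y) = meetB (f x) (f y)))"

definition gcd_subsemilattice :: "nat set \<Rightarrow> nat set \<Rightarrow> bool" where
  "gcd_subsemilattice T S \<longleftrightarrow> T \<subseteq> S \<and> (\<forall>x\<in>T. \<forall>y\<in>T. gcd x y \<in> T)"

definition has_cube_subsemilattice :: "nat set \<Rightarrow> bool" where
  "has_cube_subsemilattice S \<longleftrightarrow>
     (\<exists>T. gcd_subsemilattice T S \<and> meet_semilattice_iso (Pow {1, 2, 3 :: nat}) (\<inter>) T gcd)"

definition S13 :: "nat set" where
  "S13 = {1, 2, 3, 13, 23, 25, 41, 75, 369, 533, 6877, 16675, 3679538850}"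

end

(* Singularity is certified by a kernel vector. For the cube: each of its coatoms has four distinct
   lower bounds in the cube, so it must be 75, 369, 533, 6877, 16675 or the maximum of S13. It cannot
   be the maximum M, since gcd(M, b) = b would collapse meets. The other five form a pentagon with
   edge gcds 3, 25, 23, 13, 41 and coprime non-neighbours; having no triangle, any three of them have
   two equal pairwise gcds or a pairwise gcd equal to the triple one. *)
theory Submission
  imports Defs
begin

text \<open>One step of Euclid's algorithm, limited to literals: as a rewrite rule it halts once the
  second argument becomes \<open>0\<close> or \<open>1\<close>, which are not \<open>numeral\<close>
  terms.\<close>

lemma gcd_numeral_red:
  "gcd (numeral m) (numeral n :: nat) = gcd (numeral n) (numeral m mod numeral n)"
  by (rule gcd_red_nat)

lemma S13_dvd_max:
  assumes "x \<in> S13"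
  shows "x dvd 3679538850"
  using assms unfolding S13_def by (elim insertE emptyE) simp_all

lemma gcd_S13_max:
  assumes "x \<in> S13"
  shows "gcd x 3679538850 = x" "gcd 3679538850 x = x"
  using S13_dvd_max[OF assms] by (simp_all add: gcd_proj1_if_dvd_nat gcd_proj2_if_dvd_nat)

lemma gcd_closed_S13: "gcd_closed S13"
proof -
  have "gcd x y \<in> S13" if x: "x \<in> S13" and y: "y \<in> S13" for x y
  proof (cases "x = 3679538850 \<or> y = 3679538850")
    case True
    then show ?thesis using x y by (auto simp: gcd_S13_max)
  next
    case False
    then have "x \<in> {1, 2, 3, 13, 23, 25, 41, 75, 369, 533, 6877, 16675}"
      and "y \<in> {1, 2, 3, 13, 23, 25, 41, 75, 369, 533, 6877, 16675}"
      using x y by (simp_all add: S13_def)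
    then show ?thesis
      by (elim insertE emptyE) (simp_all add: gcd_numeral_red S13_def)
  qed
  moreover have "finite S13" "\<forall>x\<in>S13. 0 < x" by (simp_all add: S13_def)
  ultimately show ?thesis unfolding gcd_closed_def by blast
qed

text \<open>With M = 3679538850, the weight of y is e(y) * M / y, where e is 0 at 1, -1 at 2, 75,
  369, 533, 6877, 16675, and +1 elsewhere. As lcm(x,y) / y = x / gcd(x,y), row x annihilates it iff
  the e(y) / gcd(x,y) sum to 0; for x = M this is an identity of unit fractions.\<close>

definition S13_kernel :: "nat \<Rightarrow> int" where
  "S13_kernel x = the (map_of
     [(1, 0), (2, -1839769425), (3, 1226512950), (13, 283041450), (23, 159979950),
      (25, 147181554), (41, 89744850), (75, -49060518), (369, -9971650), (533, -6903450),
      (6877, -535050), (16675, -220662), (3679538850, 1)] x)"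

lemma S13_kernel_sum:
  assumes "x \<in> S13"
  shows "(\<Sum>y\<in>S13. int (lcm x y) * S13_kernel y) = 0"
  using assms unfolding S13_def S13_kernel_def
  by (elim insertE emptyE) (simp_all add: lcm_nat_def gcd_numeral_red)

text \<open>Summing over \<open>set xs\<close> instead of indices frees the certificate from the
  enumeration: one weight function serves every ordering.\<close>

lemma singular_lcm_matrixI:
  fixes w :: "nat \<Rightarrow> int"
  assumes "distinct xs"
    and kernel: "\<And>x. x \<in> set xs \<Longrightarrow> (\<Sum>y\<in>set xs. int (lcm x y) * w y) = 0"
    and nonzero: "z \<in> set xs" "w z \<noteq> 0"
  shows "singular_mat (lcm_matrix xs)"
proof -
  let ?n = "length xs"
  let ?A = "lcm_matrix xs"
  define v where "v = vec ?n (\<lambda>j. real_of_int (w (xs ! j)))"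
  have A: "?A \<in> carrier_mat ?n ?n" by (simp add: lcm_matrix_def)
  have v: "v \<in> carrier_vec ?n" by (simp add: v_def)
  obtain k where k: "k < ?n" "xs ! k = z" using nonzero(1) by (auto simp: in_set_conv_nth)
  have "v $ k \<noteq> 0\<^sub>v ?n $ k" using k nonzero(2) by (simp add: v_def)
  then have "v \<noteq> 0\<^sub>v ?n" by metis
  moreover have "?A *\<^sub>v v = 0\<^sub>v ?n"
  proof (rule eq_vecI)
    fix i assume "i < dim_vec (0\<^sub>v ?n :: real vec)"
    then have i: "i < ?n" by simp
    have "(?A *\<^sub>v v) $ i = (\<Sum>j<?n. real (lcm (xs ! i) (xs ! j)) * real_of_int (w (xs ! j)))"
      using i by (simp add: lcm_matrix_def v_def scalar_prod_def atLeast0LessThan)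
    also have "\<dots> = (\<Sum>y\<in>set xs. real (lcm (xs ! i) y) * real_of_int (w y))"
      by (rule sum.reindex_bij_betw[OF bij_betw_nth[OF assms(1) refl refl]])
    also have "\<dots> = real_of_int (\<Sum>y\<in>set xs. int (lcm (xs ! i) y) * w y)" by simp
    also have "\<dots> = 0" using kernel i by simp
    finally show "(?A *\<^sub>v v) $ i = 0\<^sub>v ?n $ i" using i by simp
  qed (simp add: lcm_matrix_def)
  ultimately have "det ?A = 0" using det_0_iff_vec_prod_zero[OF A] v by blast
  then show ?thesis using A by (auto simp: singular_mat_def)
qed

text \<open>Each other element of \<open>S13\<close> is 1, a prime, or 25 with its divisor 5 missing
  from \<open>S13\<close>, so its only divisors there are 1 and itself.\<close>

lemma S13_four_divisors:
  assumes "a \<in> S13" "p \<in> S13" "q \<in> S13" "z \<in> S13"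
    and "p dvd a" "q dvd a" "z dvd a" "distinct [a, p, q, z]"
  shows "a \<in> {75, 369, 533, 6877, 16675, 3679538850}"
proof (rule ccontr)
  assume "a \<notin> {75, 369, 533, 6877, 16675, 3679538850}"
  then have "a \<in> {1, 2, 3, 13, 23, 25, 41}" using assms(1) by (auto simp: S13_def)
  moreover have "\<forall>a\<in>{1, 2, 3, 13, 23, 25, 41}. \<forall>d\<in>S13. d dvd a \<longrightarrow> d \<in> {1, a}"
    unfolding S13_def by simp
  ultimately have "{p, q, z} \<subseteq> {1, a}" using assms(2-7) by blast
  then show False using assms(8) by auto
qed

lemma S13_no_three_coatoms:
  fixes a b c :: nat
  assumes a: "a \<in> {75, 369, 533, 6877, 16675, 3679538850}"
    and b: "b \<in> {75, 369, 533, 6877, 16675, 3679538850}"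
    and c: "c \<in> {75, 369, 533, 6877, 16675, 3679538850}"
  shows "\<not> distinct [gcd a b, gcd a c, gcd b c, gcd (gcd a b) c]"
proof (cases "a = 3679538850 \<or> b = 3679538850 \<or> c = 3679538850")
  case True
  have abc: "a \<in> S13" "b \<in> S13" "c \<in> S13"
    using a b c by (auto simp: S13_def)
  \<comment> \<open>With one argument maximal, the triple gcd is the gcd of the other two; for
    \<open>c\<close> this needs \<open>gcd a b\<close> to lie below the maximum.\<close>
  moreover have "gcd a b \<in> S13"
    using abc gcd_closed_S13 by (simp add: gcd_closed_def)
  ultimately show ?thesis using True by (auto simp: gcd_S13_max)
next
  case False
  then have "a \<in> {75, 369, 533, 6877, 16675}" "b \<in> {75, 369, 533, 6877, 16675}"
    "c \<in> {75, 369, 533, 6877, 16675}"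
    using a b c by simp_all
  \<comment> \<open>75 = 3*25, 369 = 9*41, 533 = 13*41, 6877 = 13*23*23, 16675 = 23*25*29. Three
    distinct ones include a coprime pair, so that gcd and the triple gcd are both 1; a repeated one
    makes two pairwise gcds equal.\<close>
  then show ?thesis
    by (elim insertE emptyE) (simp_all add: gcd_numeral_red)
qed

lemma not_has_cube_S13: "\<not> has_cube_subsemilattice S13"
proof
  assume "has_cube_subsemilattice S13"
  then obtain T f where T: "T \<subseteq> S13" and bij: "bij_betw f (Pow {1, 2, 3 :: nat}) T"
    and hom: "\<And>X Y. X \<subseteq> {1, 2, 3} \<Longrightarrow> Y \<subseteq> {1, 2, 3} \<Longrightarrow> f (X \<inter> Y) = gcd (f X) (f Y)"
    unfolding has_cube_subsemilattice_def gcd_subsemilattice_def meet_semilattice_iso_def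
    by (metis PowI)
  have mem: "f X \<in> S13" if "X \<subseteq> {1, 2, 3}" for X
    using bij T that by (auto simp: bij_betw_def)
  have eq_iff: "f X = f Y \<longleftrightarrow> X = Y" if "X \<subseteq> {1, 2, 3}" "Y \<subseteq> {1, 2, 3}" for X Y
    using bij that by (auto simp: bij_betw_def inj_on_def)
  have dvd: "f X dvd f Y" if "X \<subseteq> Y" "Y \<subseteq> {1, 2, 3}" for X Y
    using hom[of X Y] that by (metis gcd_dvd2 inf.absorb1 order_trans)
  let ?a = "f {1, 2}" and ?b = "f {1, 3}" and ?c = "f {2, 3}"
  have "?a \<in> {75, 369, 533, 6877, 16675, 3679538850}"
    by (rule S13_four_divisors[of _ "f {1}" "f {2}" "f {}"]) (auto intro!: mem dvd simp: eq_iff)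
  moreover have "?b \<in> {75, 369, 533, 6877, 16675, 3679538850}"
    by (rule S13_four_divisors[of _ "f {1}" "f {3}" "f {}"]) (auto intro!: mem dvd simp: eq_iff)
  moreover have "?c \<in> {75, 369, 533, 6877, 16675, 3679538850}"
    by (rule S13_four_divisors[of _ "f {2}" "f {3}" "f {}"]) (auto intro!: mem dvd simp: eq_iff)
  ultimately have "\<not> distinct [gcd ?a ?b, gcd ?a ?c, gcd ?b ?c, gcd (gcd ?a ?b) ?c]"
    by (rule S13_no_three_coatoms)
  moreover have "gcd ?a ?b = f {1}" "gcd ?a ?c = f {2}" "gcd ?b ?c = f {3}"
    using hom[of "{1, 2}" "{1, 3}"] hom[of "{1, 2}" "{2, 3}"] hom[of "{1, 3}" "{2, 3}"] by simp_all
  \<comment> \<open>The four gcds are thus the images of the three atoms and the bottom, which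
    injectivity keeps apart.\<close>
  moreover have "gcd (f {1}) ?c = f {}" using hom[of "{1}" "{2, 3}"] by simp
  ultimately show False by (simp add: eq_iff)
qed

theorem mainTheorem3:
  shows "gcd_closed S13 \<and>
    (\<forall>xs. distinct xs \<and> set xs = S13 \<longrightarrow> singular_mat (lcm_matrix xs)) \<and>
    \<not> has_cube_subsemilattice S13 \<and>
    \<not> (\<forall>S xs. gcd_closed S \<and> distinct xs \<and> set xs = S \<and> singular_mat (lcm_matrix xs)
          \<longrightarrow> has_cube_subsemilattice S)"
proof -
  have nonzero: "2 \<in> S13" "S13_kernel 2 \<noteq> 0" by (simp_all add: S13_def S13_kernel_def)
  have singular: "singular_mat (lcm_matrix xs)" if "distinct xs" "set xs = S13" for xs
    using singular_lcm_matrixI[of xs S13_kernel 2] that S13_kernel_sum nonzero by simp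
  \<comment> \<open>The refutation of the general claim needs an actual enumeration of
    \<open>S13\<close>.\<close>
  obtain xs where "set xs = S13" "distinct xs"
    using finite_distinct_list[of S13] gcd_closed_S13 by (auto simp: gcd_closed_def)
  then show ?thesis using gcd_closed_S13 singular not_has_cube_S13 by blast
qed

end
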